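(* Let $c_{RF}:[0,1]\to\mathbb{R}$ be the prediction function of a random forest regression model with a single real input feature $x\in[0,1]$, that is, $c_{RF}(x)=\frac1M\sum_{t=1}^M T_t(x)$ with $M\ge1$ regression trees $T_1,\dots,T_M$. Suppose that every split in every tree $T_t$ is monotonic (as defined in the context). Then $c_{RF}$ is weakly monotonic: for all $x_1,x_2\in[0,1]$ with $x_1\le x_2$, one has $c_{RF}(x_1)\le c_{RF}(x_2)$.
   Context: A regression tree $T$ with one real input feature $x\in[0,1]$ is a finite binary tree built from a finite training dataset. Each internal node carries a split at a threshold $s$, which sends the inputs reaching that node with $x$ on the lower side of $s$ to the left child and those on the upper side of $s$ to the right child (with one fixed convention for $x=s$). Every leaf contains at least one training sample, and the output $T(x)$ is the mean of the targets of the training samples in the leaf that $x$ reaches; in particular $T$ is constant on each leaf. For a split at $x=s$ at a node of $T$, let $L_s$ and $R_s$ be the sets of training inputs reaching that node which are sent to the left and to the right child, respectively. Writing $y=T(x)$ for the output of the tree at $x$ (with matching subscripts, e.g. $y_1=T(x_1)$, $y_L=T(x_L)$), the split is called monotonic if $$\forall x_1,x_2\in L_s:\ x_1<x_2\Rightarrow y_1\le y_2,$$ $$\forall x_1,x_2\in R_s:\ x_1<x_2\Rightarrow y_1\le y_2,$$ $$\forall x_L\in L_s,\ \forall x_R\in R_s:\ x_L<x_R\Rightarrow y_L\le y_R.$$ *)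

theory Defs
  imports Complex_Main "HOL-Library.Multiset" "HOL-Library.Tree"
begin

(* A sample is a pair (input, target). Data are multisets, so that repeated samples
   (e.g. from bootstrap resampling) count with their multiplicity in the leaf means. *)
type_synonym dataset = "(real \<times> real) multiset"

(* Inner nodes of the shape carry the split thresholds; the constant Leaf stands for a leaf
   of the regression tree. Leaf outputs are not stored: they are determined by the data. *)
record rtree =
  shape :: "real tree"
  data :: dataset

(* The flag c is the tie convention: True sends x = s to the left, False to the right. *)
definition goes_left :: "bool \<Rightarrow> real \<Rightarrow> real \<Rightarrow> bool" where
  "goes_left c s x \<longleftrightarrow> (if c then x \<le> s else x < s)"

definition left_data :: "bool \<Rightarrow> real \<Rightarrow> dataset \<Rightarrow> dataset" where
  "left_data c s D = {#p \<in># D. goes_left c s (fst p)#}"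

definition right_data :: "bool \<Rightarrow> real \<Rightarrow> dataset \<Rightarrow> dataset" where
  "right_data c s D = {#p \<in># D. \<not> goes_left c s (fst p)#}"

(* In the recursive functions below, D is the multiset of samples reaching the root of the
   given subtree. *)

fun leaf_data :: "bool \<Rightarrow> real tree \<Rightarrow> dataset \<Rightarrow> real \<Rightarrow> dataset" where
  "leaf_data c Leaf D x = D"
| "leaf_data c (Node l s r) D x =
     (if goes_left c s x then leaf_data c l (left_data c s D) x
      else leaf_data c r (right_data c s D) x)"

fun leaves_nonempty :: "bool \<Rightarrow> real tree \<Rightarrow> dataset \<Rightarrow> bool" where
  "leaves_nonempty c Leaf D \<longleftrightarrow> D \<noteq> {#}"
| "leaves_nonempty c (Node l s r) D \<longleftrightarrow>
     leaves_nonempty c l (left_data c s D) \<and> leaves_nonempty c r (right_data c s D)"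

definition mean_target :: "dataset \<Rightarrow> real" where
  "mean_target D = (\<Sum>p\<in>#D. snd p) / real (size D)"

definition inputs :: "dataset \<Rightarrow> real set" where
  "inputs D = fst ` set_mset D"

definition regression_tree :: "bool \<Rightarrow> rtree \<Rightarrow> bool" where
  "regression_tree c T \<longleftrightarrow> inputs (data T) \<subseteq> {0..1} \<and> leaves_nonempty c (shape T) (data T)"

definition tree_output :: "bool \<Rightarrow> rtree \<Rightarrow> real \<Rightarrow> real" where
  "tree_output c T x = mean_target (leaf_data c (shape T) (data T) x)"

definition monotonic_split :: "(real \<Rightarrow> real) \<Rightarrow> real set \<Rightarrow> real set \<Rightarrow> bool" where
  "monotonic_split f L R \<longleftrightarrow>
     (\<forall>x1\<in>L. \<forall>x2\<in>L. x1 < x2 \<longrightarrow> f x1 \<le> f x2) \<and>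
     (\<forall>x1\<in>R. \<forall>x2\<in>R. x1 < x2 \<longrightarrow> f x1 \<le> f x2) \<and>
     (\<forall>xL\<in>L. \<forall>xR\<in>R. xL < xR \<longrightarrow> f xL \<le> f xR)"

(* f stays the output function of the whole tree during the recursion. *)
fun splits_monotonic :: "bool \<Rightarrow> (real \<Rightarrow> real) \<Rightarrow> real tree \<Rightarrow> dataset \<Rightarrow> bool" where
  "splits_monotonic c f Leaf D \<longleftrightarrow> True"
| "splits_monotonic c f (Node l s r) D \<longleftrightarrow>
     monotonic_split f (inputs (left_data c s D)) (inputs (right_data c s D)) \<and>
     splits_monotonic c f l (left_data c s D) \<and>
     splits_monotonic c f r (right_data c s D)"

definition every_split_monotonic :: "bool \<Rightarrow> rtree \<Rightarrow> bool" where
  "every_split_monotonic c T \<longleftrightarrow> splits_monotonic c (tree_output c T) (shape T) (data T)"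

definition forest_output :: "bool \<Rightarrow> nat \<Rightarrow> (nat \<Rightarrow> rtree) \<Rightarrow> real \<Rightarrow> real" where
  "forest_output c M T x = (1 / real M) * (\<Sum>t=1..M. tree_output c (T t) x)"

end

(* Every leaf cell contains a training input, and the tree output is constant on the cell, so
   the output at any point is the output at some training input. Distinct cells are separated
   by a threshold, so this passage from points to training inputs respects the order, and it
   suffices that the output is monotone on the training inputs. The root split alone gives this:
   its three conditions cover every ordered pair of training inputs. *)
theory Submission
  imports Defs
begin

lemma leaf_data_subset: "leaf_data c t D x \<subseteq># D"
proof (induction c t D x rule: leaf_data.induct)
  case (2 c l s r D x)
  then show ?case
    by (auto simp: left_data_def right_data_def intro: subset_mset.order_trans)
qed simp

lemma inputs_leaf_data_subset: "inputs (leaf_data c t D x) \<subseteq> inputs D"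
  unfolding inputs_def by (intro image_mono set_mset_mono leaf_data_subset)

lemma inputs_left_data: "inputs (left_data c s D) = {z \<in> inputs D. goes_left c s z}"
  by (auto simp: inputs_def left_data_def)

lemma inputs_right_data: "inputs (right_data c s D) = {z \<in> inputs D. \<not> goes_left c s z}"
  by (auto simp: inputs_def right_data_def)

lemma leaf_data_nonempty: "leaves_nonempty c t D \<Longrightarrow> leaf_data c t D x \<noteq> {#}"
  by (induction c t D x rule: leaf_data.induct) auto

text \<open>A sample survives the filters down to the leaf of \<open>x\<close> only by giving the
  same answer as \<open>x\<close> at each split, so its input follows the same path. This lets a
  training input stand in for \<open>x\<close>.\<close>

lemma leaf_data_input_same_leaf:
  "z \<in> inputs (leaf_data c t D x) \<Longrightarrow> leaf_data c t D z = leaf_data c t D x"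
proof (induction c t D x rule: leaf_data.induct)
  case (2 c l s r D x)
  then show ?case
    using inputs_leaf_data_subset[of c l "left_data c s D" x]
      inputs_leaf_data_subset[of c r "right_data c s D" x]
    by (auto simp: inputs_left_data inputs_right_data split: if_splits)
qed simp

lemma goes_left_mono: "goes_left c s y \<Longrightarrow> x \<le> y \<Longrightarrow> goes_left c s x"
  by (auto simp: goes_left_def split: if_splits)

text \<open>Different data force the paths of \<open>x\<close> and \<open>y\<close> to part at some
  node; since \<open>x \<le> y\<close>, it is \<open>x\<close> that goes left there, and the
  threshold separates the samples of the two leaves.\<close>

lemma leaf_data_ordered:
  assumes "x \<le> y" "leaf_data c t D x \<noteq> leaf_data c t D y"
    and "u \<in> inputs (leaf_data c t D x)" "v \<in> inputs (leaf_data c t D y)"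
  shows "u < v"
  using assms
proof (induction t arbitrary: D)
  case (Node l s r)
  consider "goes_left c s x" "goes_left c s y" | "\<not> goes_left c s x" "\<not> goes_left c s y"
    | "goes_left c s x" "\<not> goes_left c s y"
    using goes_left_mono Node.prems(1) by blast
  then show ?case
  proof cases
    case 3
    then have "u \<in> inputs (left_data c s D)" "v \<in> inputs (right_data c s D)"
      using Node.prems by (auto dest: subsetD[OF inputs_leaf_data_subset])
    then have "goes_left c s u" "\<not> goes_left c s v"
      by (auto simp: inputs_left_data inputs_right_data)
    \<comment> \<open>If \<open>v \<le> u\<close>, then \<open>v\<close> would go left together with
      \<open>u\<close>.\<close>
    then show ?thesis
      using goes_left_mono not_le by blast
  qed (use Node in auto)
qed simp

lemma tree_output_mono_on_inputs:
  assumes "every_split_monotonic c T"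
  shows "mono_on (inputs (data T)) (tree_output c T)"
proof (cases "shape T")
  \<comment> \<open>Without a root split the hypothesis says nothing, but the output is
    constant.\<close>
  case Leaf
  then show ?thesis
    by (simp add: tree_output_def mono_on_def)
next
  case (Node l s r)
  let ?L = "inputs (left_data c s (data T))" and ?R = "inputs (right_data c s (data T))"
  have split: "monotonic_split (tree_output c T) ?L ?R"
    using assms Node by (simp add: every_split_monotonic_def)
  show ?thesis
  proof (rule mono_onI)
    fix u v assume uv: "u \<in> inputs (data T)" "v \<in> inputs (data T)" "u \<le> v"
    \<comment> \<open>The fourth combination, \<open>u\<close> right and \<open>v\<close> left,
      would contradict \<open>u \<le> v\<close>.\<close>
    then have "u \<in> ?L \<and> v \<in> ?L \<or> u \<in> ?R \<and> v \<in> ?R \<or> u \<in> ?L \<and> v \<in> ?R"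
      using goes_left_mono by (auto simp: inputs_left_data inputs_right_data)
    then show "tree_output c T u \<le> tree_output c T v"
      \<comment> \<open>The split conditions compare only strictly ordered inputs, so
        \<open>u = v\<close> is treated apart.\<close>
      using split uv(3) unfolding monotonic_split_def by (cases "u = v") auto
  qed
qed

lemma tree_output_mono:
  assumes "regression_tree c T" "every_split_monotonic c T"
  shows "mono (tree_output c T)"
proof (rule monoI)
  fix x y :: real assume "x \<le> y"
  let ?leaf = "leaf_data c (shape T) (data T)"
  show "tree_output c T x \<le> tree_output c T y"
  \<comment> \<open>Comparing the data instead of the leaves is enough: equal data have equal
    means.\<close>
  proof (cases "?leaf x = ?leaf y")
    case True
    then show ?thesis
      by (simp add: tree_output_def)
  next
    case False
    have "?leaf z \<noteq> {#}" for z
      using assms(1) leaf_data_nonempty by (auto simp: regression_tree_def)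
    then have "inputs (?leaf z) \<noteq> {}" for z
      by (simp add: inputs_def)
    then obtain u v where uv: "u \<in> inputs (?leaf x)" "v \<in> inputs (?leaf y)"
      by blast
    have "tree_output c T u \<le> tree_output c T v"
    proof (rule mono_onD[OF tree_output_mono_on_inputs[OF assms(2)]])
      show "u \<in> inputs (data T)" "v \<in> inputs (data T)"
        using uv inputs_leaf_data_subset by blast+
      show "u \<le> v"
        using leaf_data_ordered[OF \<open>x \<le> y\<close> False uv] by simp
    qed
    then show ?thesis
      using uv by (simp add: tree_output_def leaf_data_input_same_leaf)
  qed
qed

theorem proposition2:
  fixes c :: bool and M :: nat and T :: "nat \<Rightarrow> rtree"
  assumes "M \<ge> 1"
    and "\<And>t. t \<in> {1..M} \<Longrightarrow> regression_tree c (T t)"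
    and "\<And>t. t \<in> {1..M} \<Longrightarrow> every_split_monotonic c (T t)"
  shows "\<forall>x1\<in>{0..1}. \<forall>x2\<in>{0..1}. x1 \<le> x2 \<longrightarrow> forest_output c M T x1 \<le> forest_output c M T x2"
  unfolding forest_output_def
  by (intro ballI impI mult_left_mono sum_mono monoD[OF tree_output_mono] assms) auto

end
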